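(* Let $\mathcal{E}:\mathrm{L}^2(X,m)\to[0,\infty]$ be a $2$-homogeneous nonlinear Dirichlet form. Then the following hold. 1. For all $u\in D(\partial\mathcal{E})$, all $\xi\in\partial\mathcal{E}(u)$ and all $v\in D(\mathcal{E})$, $$\Lambda^-(u,v)\le(\xi,v)\le\Lambda^+(u,v).$$ In particular, if $\mathcal{E}$ is such that $\Lambda^+(u,\cdot)=\Lambda^-(u,\cdot)$ on $D(\mathcal{E})$ and $\mathcal{E}$ is subdifferentiable at $u$ (i.e. $u\in D(\partial\mathcal{E})$), then $\partial\mathcal{E}(u)$ contains only one element, and, denoting this element again by $\partial\mathcal{E}(u)$, $$\forall v\in D(\mathcal{E}),\qquad \Lambda^\pm(u,v)=(\partial\mathcal{E}(u),v).$$ 2. For $\lambda>0$, let $A_\lambda$ be the Yosida regularisation of $\partial\mathcal{E}$. Then, for all $u,v\in D(\mathcal{E})$, $$\Lambda^-(u,v)\le\liminf_{\lambda\to0}(A_\lambda(u),v)\le\limsup_{\lambda\to0}(A_\lambda(u),v)\le\Lambda^+(u,v).$$ In particular, if $\mathcal{E}$ is regular, then $\lim_{\lambda\to0}(A_\lambda(u),v)=\Lambda(u,v)$ for all $u,v\in D(\mathcal{E})$, where $\Lambda:=\Lambda^+=\Lambda^-$.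
   Context: $(X,\mathcal{F},m)$ is a $\sigma$-finite measure space such that $\mathcal{F}$ is in bi-measurable correspondence with the Borel class on $\mathbb{R}$; $\mathrm{L}^2(X,m)$ is the real Hilbert space of square-integrable functions, with scalar product $(\cdot,\cdot)$. For $\mathcal{E}:\mathrm{L}^2(X,m)\to[0,\infty]$, $D(\mathcal{E})=\{u:\mathcal{E}(u)\neq\infty\}$. $\mathcal{E}$ is $2$-homogeneous if $\mathcal{E}(\nu u)=\nu^2\mathcal{E}(u)$ for all $\nu\in\mathbb{R}$, $u\in\mathrm{L}^2(X,m)$ (convention $0\cdot\infty=0$). Subdifferential: for $u\in D(\mathcal{E})$, $\partial\mathcal{E}(u)=\{\xi\in\mathrm{L}^2(X,m): \mathcal{E}(z)-\mathcal{E}(u)\ge(\xi,z-u) \ \forall z\in\mathrm{L}^2(X,m)\}$; $D(\partial\mathcal{E})=\{u\in D(\mathcal{E}):\partial\mathcal{E}(u)\neq\emptyset\}$. Nonlinear Dirichlet form: a convex, lower semicontinuous (in $\mathrm{L}^2$) functional $\mathcal{E}:\mathrm{L}^2(X,m)\to[0,\infty]$ with dense domain $D(\mathcal{E})$, whose gradient flow semigroup $(T_t)_{t\ge0}$ on $\mathrm{L}^2(X,m)$, i.e. the unique solution of $\partial_tT_tu\in-\partial\mathcal{E}(T_tu)$ for $t>0$, $T_0u=u$, satisfies: (i) contraction in all $\mathrm{L}^p$: $\|T_tu-T_tv\|_{\mathrm{L}^p}\le\|u-v\|_{\mathrm{L}^p}$ for all $t\ge0$, $p\in[1,\infty]$,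 $u,v\in\mathrm{L}^2(X,m)$ (the right-hand side may be $+\infty$); (ii) order preservation: $u\ge v$ implies $T_tu\ge T_tv$ for all $t\ge0$, $u,v\in\mathrm{L}^2(X,m)$. Slopes: $\Lambda^\pm(u,v)=\lim_{\sigma\to0^\pm}\frac{\mathcal{E}(u+\sigma v)-\mathcal{E}(u)}{\sigma}$ for $u,v\in D(\mathcal{E})$ (the limits exist and are finite). $\mathcal{E}$ is regular if $\Lambda^+(u,\cdot)=\Lambda^-(u,\cdot)$ on $D(\mathcal{E})$ for every $u\in D(\mathcal{E})$. Yosida regularisation: for $\lambda>0$, $A_\lambda=\frac1\lambda(\mathrm{Id}-(\mathrm{Id}+\lambda\,\partial\mathcal{E})^{-1}):\mathrm{L}^2(X,m)\to\mathrm{L}^2(X,m)$; equivalently $A_\lambda$ is the gradient of $\mathcal{E}_\lambda(u)=\inf_{w\in\mathrm{L}^2(X,m)}\{\mathcal{E}(w)+\frac1{2\lambda}\|u-w\|_{\mathrm{L}^2(X,m)}^2\}$. *)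

theory Defs
  imports "HOL-Analysis.Analysis" "HOL-Probability.Essential_Supremum"
begin

text \<open>
  Elements of \<open>L\<^sup>2(X, m)\<close> are represented by measurable functions. Equality in \<open>L\<^sup>2\<close> is
  equality almost everywhere, and functionals are required to respect it.
\<close>

definition bimeasurable_with_real :: "'a measure \<Rightarrow> bool" where
  "bimeasurable_with_real M \<longleftrightarrow>
     (\<exists>f \<in> M \<rightarrow>\<^sub>M (borel :: real measure). \<exists>g \<in> borel \<rightarrow>\<^sub>M M.
        (\<forall>x \<in> space M. g (f x) = x) \<and> (\<forall>r. f (g r) = r))"

definition L2 :: "'a measure \<Rightarrow> ('a \<Rightarrow> real) set" where
  "L2 M = {f \<in> borel_measurable M. integrable M (\<lambda>x. (f x)\<^sup>2)}"

definition l2_inner :: "'a measure \<Rightarrow> ('a \<Rightarrow> real) \<Rightarrow> ('a \<Rightarrow> real) \<Rightarrow> real" where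
  "l2_inner M f g = (\<integral>x. f x * g x \<partial>M)"

definition l2_norm :: "'a measure \<Rightarrow> ('a \<Rightarrow> real) \<Rightarrow> real" where
  "l2_norm M f = sqrt (l2_inner M f f)"

definition Lp_norm :: "'a measure \<Rightarrow> ennreal \<Rightarrow> ('a \<Rightarrow> real) \<Rightarrow> ennreal" where
  "Lp_norm M p f =
     (if p = \<infinity> then esssup M (\<lambda>x. ennreal \<bar>f x\<bar>)
      else (let I = (\<integral>\<^sup>+ x. ennreal (\<bar>f x\<bar> powr enn2real p) \<partial>M)
            in if I = \<infinity> then \<infinity> else ennreal (enn2real I powr (1 / enn2real p))))"

text \<open>
  A functional on \<open>L\<^sup>2(X, m)\<close> with values in \<open>[0, \<infinity>]\<close>. The values of \<open>E\<close> at functions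
  outside \<open>L2 M\<close> play no role.
\<close>

definition L2_functional :: "'a measure \<Rightarrow> (('a \<Rightarrow> real) \<Rightarrow> ennreal) \<Rightarrow> bool" where
  "L2_functional M E \<longleftrightarrow>
     (\<forall>u \<in> L2 M. \<forall>v \<in> L2 M. (AE x in M. u x = v x) \<longrightarrow> E u = E v)"

definition form_dom :: "'a measure \<Rightarrow> (('a \<Rightarrow> real) \<Rightarrow> ennreal) \<Rightarrow> ('a \<Rightarrow> real) set" where
  "form_dom M E = {u \<in> L2 M. E u \<noteq> \<infinity>}"

definition two_homogeneous :: "'a measure \<Rightarrow> (('a \<Rightarrow> real) \<Rightarrow> ennreal) \<Rightarrow> bool" where
  "two_homogeneous M E \<longleftrightarrow>
     (\<forall>u \<in> L2 M. \<forall>\<nu>::real. E (\<lambda>x. \<nu> * u x) = ennreal (\<nu>\<^sup>2) * E u)"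

definition convex_functional :: "'a measure \<Rightarrow> (('a \<Rightarrow> real) \<Rightarrow> ennreal) \<Rightarrow> bool" where
  "convex_functional M E \<longleftrightarrow>
     (\<forall>u \<in> L2 M. \<forall>v \<in> L2 M. \<forall>t \<in> {0..1::real}.
        E (\<lambda>x. t * u x + (1 - t) * v x) \<le> ennreal t * E u + ennreal (1 - t) * E v)"

definition lsc_functional :: "'a measure \<Rightarrow> (('a \<Rightarrow> real) \<Rightarrow> ennreal) \<Rightarrow> bool" where
  "lsc_functional M E \<longleftrightarrow>
     (\<forall>u \<in> L2 M. \<forall>w. (\<forall>n. w n \<in> L2 M) \<and>
        (\<lambda>n. l2_norm M (\<lambda>x. w n x - u x)) \<longlonglongrightarrow> 0 \<longrightarrow> E u \<le> liminf (\<lambda>n. E (w n)))"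

definition densely_defined :: "'a measure \<Rightarrow> (('a \<Rightarrow> real) \<Rightarrow> ennreal) \<Rightarrow> bool" where
  "densely_defined M E \<longleftrightarrow>
     (\<forall>u \<in> L2 M. \<forall>\<epsilon>>0. \<exists>w \<in> form_dom M E. l2_norm M (\<lambda>x. w x - u x) < \<epsilon>)"

text \<open>
  The subdifferential is set to be empty outside the domain; differences of values of \<open>E\<close>
  are taken in \<^typ>\<open>ereal\<close> because subtraction on \<^typ>\<open>ennreal\<close> truncates.
\<close>

definition subdiff ::
    "'a measure \<Rightarrow> (('a \<Rightarrow> real) \<Rightarrow> ennreal) \<Rightarrow> ('a \<Rightarrow> real) \<Rightarrow> ('a \<Rightarrow> real) set" where
  "subdiff M E u = {\<xi> \<in> L2 M. u \<in> form_dom M E \<and>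
     (\<forall>z \<in> L2 M. enn2ereal (E z) - enn2ereal (E u) \<ge> ereal (l2_inner M \<xi> (\<lambda>x. z x - u x)))}"

definition dom_subdiff :: "'a measure \<Rightarrow> (('a \<Rightarrow> real) \<Rightarrow> ennreal) \<Rightarrow> ('a \<Rightarrow> real) set" where
  "dom_subdiff M E = {u \<in> form_dom M E. subdiff M E u \<noteq> {}}"

definition L2_continuous_on :: "'a measure \<Rightarrow> real set \<Rightarrow> (real \<Rightarrow> 'a \<Rightarrow> real) \<Rightarrow> bool" where
  "L2_continuous_on M S y \<longleftrightarrow>
     (\<forall>t \<in> S. ((\<lambda>s. l2_norm M (\<lambda>x. y s x - y t x)) \<longlongrightarrow> 0) (at t within S))"

definition L2_absolutely_continuous_on ::
    "'a measure \<Rightarrow> real \<Rightarrow> real \<Rightarrow> (real \<Rightarrow> 'a \<Rightarrow> real) \<Rightarrow> bool" where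
  "L2_absolutely_continuous_on M a b y \<longleftrightarrow>
     (\<forall>\<epsilon>>0. \<exists>\<delta>>0. \<forall>(n::nat) l r.
        (\<forall>i<n. a \<le> l i \<and> l i \<le> r i \<and> r i \<le> b) \<and>
        (\<forall>i<n. \<forall>j<n. i \<noteq> j \<longrightarrow> {l i<..<r i} \<inter> {l j<..<r j} = {}) \<and>
        (\<Sum>i<n. r i - l i) < \<delta> \<longrightarrow>
        (\<Sum>i<n. l2_norm M (\<lambda>x. y (r i) x - y (l i) x)) < \<epsilon>)"

definition has_L2_derivative ::
    "'a measure \<Rightarrow> (real \<Rightarrow> 'a \<Rightarrow> real) \<Rightarrow> ('a \<Rightarrow> real) \<Rightarrow> real \<Rightarrow> bool" where
  "has_L2_derivative M y d t \<longleftrightarrow>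
     ((\<lambda>h. l2_norm M (\<lambda>x. (y (t + h) x - y t x) / h - d x)) \<longlongrightarrow> 0) (at 0)"

text \<open>
  Strong solutions, in the sense of Brezis, of \<open>y' \<in> - \<partial>E(y)\<close> with \<open>y(0) = u\<close>: the inclusion
  holds at almost every \<open>t > 0\<close>, and \<open>y\<close> is continuous on \<open>[0, \<infinity>)\<close> and absolutely continuous
  on compact subintervals of \<open>(0, \<infinity>)\<close>.
\<close>

definition gradient_flow_curve ::
    "'a measure \<Rightarrow> (('a \<Rightarrow> real) \<Rightarrow> ennreal) \<Rightarrow> ('a \<Rightarrow> real) \<Rightarrow> (real \<Rightarrow> 'a \<Rightarrow> real) \<Rightarrow> bool" where
  "gradient_flow_curve M E u y \<longleftrightarrow>
     (\<forall>t\<ge>0. y t \<in> L2 M) \<and>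
     (AE x in M. y 0 x = u x) \<and>
     L2_continuous_on M {0..} y \<and>
     (\<forall>a b. 0 < a \<and> a \<le> b \<longrightarrow> L2_absolutely_continuous_on M a b y) \<and>
     (AE t in lborel. t > 0 \<longrightarrow>
        (\<exists>\<xi> \<in> subdiff M E (y t). has_L2_derivative M y (\<lambda>x. - \<xi> x) t))"

definition gradient_flow_semigroup ::
    "'a measure \<Rightarrow> (('a \<Rightarrow> real) \<Rightarrow> ennreal) \<Rightarrow> (real \<Rightarrow> ('a \<Rightarrow> real) \<Rightarrow> 'a \<Rightarrow> real) \<Rightarrow> bool" where
  "gradient_flow_semigroup M E T \<longleftrightarrow>
     (\<forall>u \<in> L2 M. gradient_flow_curve M E u (\<lambda>t. T t u) \<and>
        (\<forall>y. gradient_flow_curve M E u y \<longrightarrow> (\<forall>t\<ge>0. AE x in M. y t x = T t u x)))"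

definition nonlinear_Dirichlet_form :: "'a measure \<Rightarrow> (('a \<Rightarrow> real) \<Rightarrow> ennreal) \<Rightarrow> bool" where
  "nonlinear_Dirichlet_form M E \<longleftrightarrow>
     L2_functional M E \<and> convex_functional M E \<and> lsc_functional M E \<and> densely_defined M E \<and>
     (\<exists>T. gradient_flow_semigroup M E T \<and>
        (\<forall>t\<ge>0. \<forall>p\<ge>1. \<forall>u \<in> L2 M. \<forall>v \<in> L2 M.
           Lp_norm M p (\<lambda>x. T t u x - T t v x) \<le> Lp_norm M p (\<lambda>x. u x - v x)) \<and>
        (\<forall>t\<ge>0. \<forall>u \<in> L2 M. \<forall>v \<in> L2 M.
           (AE x in M. u x \<ge> v x) \<longrightarrow> (AE x in M. T t u x \<ge> T t v x)))"

definition diff_quotient ::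
    "(('a \<Rightarrow> real) \<Rightarrow> ennreal) \<Rightarrow> ('a \<Rightarrow> real) \<Rightarrow> ('a \<Rightarrow> real) \<Rightarrow> real \<Rightarrow> ereal" where
  "diff_quotient E u v \<sigma> = (enn2ereal (E (\<lambda>x. u x + \<sigma> * v x)) - enn2ereal (E u)) / ereal \<sigma>"

definition slope_plus ::
    "(('a \<Rightarrow> real) \<Rightarrow> ennreal) \<Rightarrow> ('a \<Rightarrow> real) \<Rightarrow> ('a \<Rightarrow> real) \<Rightarrow> ereal" where
  "slope_plus E u v = Lim (at_right 0) (diff_quotient E u v)"

definition slope_minus ::
    "(('a \<Rightarrow> real) \<Rightarrow> ennreal) \<Rightarrow> ('a \<Rightarrow> real) \<Rightarrow> ('a \<Rightarrow> real) \<Rightarrow> ereal" where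
  "slope_minus E u v = Lim (at_left 0) (diff_quotient E u v)"

definition regular_form :: "'a measure \<Rightarrow> (('a \<Rightarrow> real) \<Rightarrow> ennreal) \<Rightarrow> bool" where
  "regular_form M E \<longleftrightarrow>
     (\<forall>u \<in> form_dom M E. \<forall>v \<in> form_dom M E. slope_plus E u v = slope_minus E u v)"

text \<open>
  The resolvent \<open>(Id + \<lambda> \<partial>E)\<^sup>-\<^sup>1 u\<close> is the (almost everywhere unique) \<open>w\<close> with
  \<open>u \<in> w + \<lambda> \<partial>E(w)\<close>; a representative is chosen.
\<close>

definition resolvent ::
    "'a measure \<Rightarrow> (('a \<Rightarrow> real) \<Rightarrow> ennreal) \<Rightarrow> real \<Rightarrow> ('a \<Rightarrow> real) \<Rightarrow> 'a \<Rightarrow> real" where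
  "resolvent M E lam u =
     (SOME w. w \<in> L2 M \<and> (\<exists>\<xi> \<in> subdiff M E w. AE x in M. u x = w x + lam * \<xi> x))"

definition yosida ::
    "'a measure \<Rightarrow> (('a \<Rightarrow> real) \<Rightarrow> ennreal) \<Rightarrow> real \<Rightarrow> ('a \<Rightarrow> real) \<Rightarrow> 'a \<Rightarrow> real" where
  "yosida M E lam u = (\<lambda>x. (1 / lam) * (u x - resolvent M E lam u x))"

end

theory Submission
  imports Defs
begin

text \<open>
  Two facts about a convex, lower semicontinuous, two-homogeneous energy \<open>E\<close> carry the proof.
  By homogeneity and convexity its domain is a linear subspace, so along every line
  \<open>s \<mapsto> u + s v\<close> inside the domain \<open>E\<close> is a finite convex function: its difference
  quotients are monotone, the slopes exist as monotone limits, and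
  \<open>\<Lambda>\<^sup>-(u, v) = - \<Lambda>\<^sup>+(u, - v)\<close>. Hence only upper bounds have to be proved, and an upper
  bound by \<open>\<Lambda>\<^sup>+(u, v)\<close> amounts to one by every difference quotient with \<open>s > 0\<close>.

  For a subgradient \<open>\<xi>\<close> at \<open>u\<close> this bound is the subgradient inequality at \<open>u + s v\<close>. If the two
  slopes agree, they determine \<open>(\<xi>, v)\<close> for all \<open>v\<close> in a dense set, which makes \<open>\<xi>\<close> unique.

  For the Yosida regularisation let \<open>w\<close> be the resolvent of \<open>u\<close> at \<open>\<lambda>\<close>, so that
  \<open>A\<^sub>\<lambda> u = (u - w) / \<lambda>\<close> is a subgradient at \<open>w\<close>. Testing its inequality at
  \<open>u + s v\<close>, rather than at \<open>w + s v\<close>, gives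
  \<open>\<lambda> \<parallel>A\<^sub>\<lambda> u\<parallel>\<^sup>2 + s (A\<^sub>\<lambda> u, v) \<le> E(u + s v) - E(w)\<close>.
  The first term is nonnegative and can be dropped; with \<open>s = 0\<close> the same inequality shows that
  \<open>\<parallel>u - w\<parallel>\<^sup>2 \<le> \<lambda> E(u)\<close>, so \<open>w\<close> tends to \<open>u\<close> and lower semicontinuity replaces \<open>E(w)\<close> by
  \<open>E(u)\<close> in the limit.

  The resolvent is the minimiser of \<open>E(z) + \<parallel>u - z\<parallel>\<^sup>2 / (2 \<lambda>)\<close>. It exists because, by the
  parallelogram law, minimising sequences are Cauchy, and \<open>L\<^sup>2\<close> is complete.
\<close>

section \<open>The space of square-integrable functions\<close>

lemma L2_measurable [measurable_dest]: "f \<in> L2 M \<Longrightarrow> f \<in> borel_measurable M"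
  by (simp add: L2_def)

lemma L2_integrable_square: "f \<in> L2 M \<Longrightarrow> integrable M (\<lambda>x. (f x)\<^sup>2)"
  by (simp add: L2_def)

lemma L2_integrable_mult:
  assumes "f \<in> L2 M" "g \<in> L2 M"
  shows "integrable M (\<lambda>x. f x * g x)"
proof (rule Bochner_Integration.integrable_bound)
  show "integrable M (\<lambda>x. (f x)\<^sup>2 + (g x)\<^sup>2)"
    using assms by (intro Bochner_Integration.integrable_add L2_integrable_square)
  show "(\<lambda>x. f x * g x) \<in> borel_measurable M"
    using assms[THEN L2_measurable] by simp
  have "\<bar>a * b\<bar> \<le> a\<^sup>2 + b\<^sup>2" for a b :: real
  proof -
    have "2 * (\<bar>a\<bar> * \<bar>b\<bar>) \<le> a\<^sup>2 + b\<^sup>2"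
      using sum_squares_bound[of "\<bar>a\<bar>" "\<bar>b\<bar>"] by simp
    moreover have "0 \<le> \<bar>a\<bar> * \<bar>b\<bar>" by simp
    ultimately show ?thesis unfolding abs_mult by linarith
  qed
  then show "AE x in M. norm (f x * g x) \<le> norm ((f x)\<^sup>2 + (g x)\<^sup>2)"
    by simp
qed

lemma L2_lincomb:
  assumes "f \<in> L2 M" "g \<in> L2 M"
  shows "(\<lambda>x. a * f x + b * g x) \<in> L2 M"
proof -
  have "(\<lambda>x. (a * f x + b * g x)\<^sup>2) =
      (\<lambda>x. a\<^sup>2 * (f x)\<^sup>2 + (2 * a * b) * (f x * g x) + b\<^sup>2 * (g x)\<^sup>2)"
    by (auto simp: power2_eq_square algebra_simps)
  moreover have "integrable M (\<lambda>x. a\<^sup>2 * (f x)\<^sup>2 + (2 * a * b) * (f x * g x) + b\<^sup>2 * (g x)\<^sup>2)"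
    using assms
    by (intro Bochner_Integration.integrable_add integrable_mult_right
          L2_integrable_square L2_integrable_mult)
  ultimately show ?thesis
    using assms[THEN L2_measurable] by (simp add: L2_def)
qed

lemma L2_diff: "f \<in> L2 M \<Longrightarrow> g \<in> L2 M \<Longrightarrow> (\<lambda>x. f x - g x) \<in> L2 M"
  using L2_lincomb[of f M g 1 "-1"] by simp

lemma L2_scale: "f \<in> L2 M \<Longrightarrow> (\<lambda>x. a * f x) \<in> L2 M"
  using L2_lincomb[of f M f a 0] by simp

lemma L2_zero: "(\<lambda>x. 0) \<in> L2 M"
  by (simp add: L2_def)

lemma l2_inner_commute: "l2_inner M f g = l2_inner M g f"
  by (simp add: l2_inner_def mult.commute)

lemma l2_inner_lincomb_left:
  assumes "f \<in> L2 M" "g \<in> L2 M" "h \<in> L2 M"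
  shows "l2_inner M (\<lambda>x. a * f x + b * g x) h = a * l2_inner M f h + b * l2_inner M g h"
proof -
  have "(\<lambda>x. (a * f x + b * g x) * h x) = (\<lambda>x. a * (f x * h x) + b * (g x * h x))"
    by (auto simp: algebra_simps)
  then show ?thesis
    unfolding l2_inner_def using assms by (simp add: L2_integrable_mult)
qed

lemma l2_inner_lincomb_right:
  assumes "f \<in> L2 M" "g \<in> L2 M" "h \<in> L2 M"
  shows "l2_inner M h (\<lambda>x. a * f x + b * g x) = a * l2_inner M h f + b * l2_inner M h g"
  using l2_inner_lincomb_left[OF assms] by (simp add: l2_inner_commute)

lemma l2_inner_diff_left:
  assumes "f \<in> L2 M" "g \<in> L2 M" "h \<in> L2 M"
  shows "l2_inner M (\<lambda>x. f x - g x) h = l2_inner M f h - l2_inner M g h"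
  using l2_inner_lincomb_left[OF assms, of 1 "-1"] by simp

lemma l2_inner_diff_right:
  assumes "f \<in> L2 M" "g \<in> L2 M" "h \<in> L2 M"
  shows "l2_inner M h (\<lambda>x. f x - g x) = l2_inner M h f - l2_inner M h g"
  using l2_inner_lincomb_right[OF assms, of 1 "-1"] by simp

lemma l2_inner_scale_left: "l2_inner M (\<lambda>x. a * f x) g = a * l2_inner M f g"
  by (simp add: l2_inner_def mult.assoc)

lemma l2_inner_scale_right: "l2_inner M f (\<lambda>x. a * g x) = a * l2_inner M f g"
  using l2_inner_scale_left[of M a g f] by (simp add: l2_inner_commute)

lemma l2_inner_lincomb_self:
  assumes "f \<in> L2 M" "g \<in> L2 M"
  shows "l2_inner M (\<lambda>x. a * f x + b * g x) (\<lambda>x. a * f x + b * g x) =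
    a\<^sup>2 * l2_inner M f f + 2 * a * b * l2_inner M f g + b\<^sup>2 * l2_inner M g g"
  using assms
  by (simp add: l2_inner_lincomb_left l2_inner_lincomb_right L2_lincomb
      l2_inner_commute[of M g f] power2_eq_square algebra_simps)

lemma l2_inner_self_nonneg: "0 \<le> l2_inner M f f"
  by (simp add: l2_inner_def)

lemma l2_inner_Cauchy_Schwarz:
  assumes "f \<in> L2 M" "g \<in> L2 M"
  shows "(l2_inner M f g)\<^sup>2 \<le> l2_inner M f f * l2_inner M g g"
proof -
  let ?a = "l2_inner M f f" and ?b = "l2_inner M f g" and ?c = "l2_inner M g g"
  have pos: "0 \<le> s\<^sup>2 * ?a + 2 * s * t * ?b + t\<^sup>2 * ?c" for s t
    using l2_inner_lincomb_self[OF assms, of s t] l2_inner_self_nonneg by metis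
  show ?thesis
  proof (cases "?c = 0")
    case False
    then have "0 < ?c" using l2_inner_self_nonneg[of M g] by simp
    moreover have "0 \<le> ?c * (?a * ?c - ?b\<^sup>2)"
      using pos[of "?c" "- ?b"] by (simp add: power2_eq_square algebra_simps)
    ultimately show ?thesis by (simp add: zero_le_mult_iff)
  next
    case True
    have "?b = 0"
    proof (rule ccontr)
      assume "?b \<noteq> 0"
      (* This coefficient of g makes the quadratic form equal to -1. *)
      have "0 \<le> ?a + 2 * (- (?a + 1) / (2 * ?b)) * ?b"
        using pos[of 1 "- (?a + 1) / (2 * ?b)"] True by simp
      then show False using \<open>?b \<noteq> 0\<close> by (simp add: field_simps)
    qed
    then show ?thesis using True by simp
  qed
qed

lemma l2_inner_cong_AE:
  assumes "AE x in M. f x = f' x" "f \<in> borel_measurable M" "f' \<in> borel_measurable M" "g \<in> L2 M"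
  shows "l2_inner M f g = l2_inner M f' g"
  unfolding l2_inner_def
  by (rule integral_cong_AE) (use assms L2_measurable[OF assms(4)] in auto)

lemma AE_zero_of_l2_inner_self:
  assumes "f \<in> L2 M" "l2_inner M f f = 0"
  shows "AE x in M. f x = 0"
proof -
  have "(\<integral>x. (f x)\<^sup>2 \<partial>M) = 0"
    using assms(2) by (simp add: l2_inner_def power2_eq_square)
  then have "AE x in M. (f x)\<^sup>2 = 0"
    using integral_nonneg_eq_0_iff_AE[OF L2_integrable_square[OF assms(1)]] by simp
  then show ?thesis by simp
qed

lemma nn_integral_square_L2:
  assumes "f \<in> L2 M"
  shows "(\<integral>\<^sup>+x. ennreal ((f x)\<^sup>2) \<partial>M) = ennreal (l2_inner M f f)"
  using nn_integral_eq_integral[OF L2_integrable_square[OF assms]]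
  by (simp add: l2_inner_def power2_eq_square)

lemma L2_of_nn_integral_square_le:
  assumes [measurable]: "f \<in> borel_measurable M"
    and le: "(\<integral>\<^sup>+x. ennreal ((f x)\<^sup>2) \<partial>M) \<le> ennreal c" and "0 \<le> c"
  shows "f \<in> L2 M" "l2_inner M f f \<le> c"
proof -
  have "integrable M (\<lambda>x. (f x)\<^sup>2)"
    by (rule integrableI_bounded) (use le in \<open>auto intro: le_less_trans[OF le]\<close>)
  then show "f \<in> L2 M" by (simp add: L2_def)
  then show "l2_inner M f f \<le> c"
    using le \<open>0 \<le> c\<close> by (simp add: nn_integral_square_L2)
qed

text \<open>
  Completeness in the form needed for minimising sequences, whose rate of convergence can be
  prescribed. The rate makes \<open>\<Sum>n. 2\<^sup>n (w\<^sub>n\<^sub>+\<^sub>1 - w\<^sub>n)\<^sup>2\<close> integrable, hence finite almost everywhere, so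
  the increments decay geometrically at almost every point and \<open>w\<^sub>n\<close> converges pointwise. Fatou's
  lemma then turns the Cauchy estimate into convergence in norm.
\<close>

lemma L2_complete_fast:
  assumes w: "\<And>n. w n \<in> L2 M" and "0 \<le> C"
    and fast: "\<And>m n. n \<le> m \<Longrightarrow>
      l2_inner M (\<lambda>x. w m x - w n x) (\<lambda>x. w m x - w n x) \<le> C * (1/4) ^ n"
  shows "\<exists>u \<in> L2 M. (\<lambda>n. l2_norm M (\<lambda>x. w n x - u x)) \<longlonglongrightarrow> 0"
proof -
  have wm [measurable]: "w n \<in> borel_measurable M" for n
    by (rule L2_measurable[OF w])
  define d where "d n x = w (Suc n) x - w n x" for n x
  have dL2: "d n \<in> L2 M" for n
    unfolding d_def using w by (intro L2_diff)
  have [measurable]: "d n \<in> borel_measurable M" for n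
    by (rule L2_measurable[OF dL2])
  define S where "S x = (\<Sum>n. ennreal (2 ^ n * (d n x)\<^sup>2))" for x
  have "(\<integral>\<^sup>+x. S x \<partial>M) = (\<Sum>n. \<integral>\<^sup>+x. ennreal (2 ^ n * (d n x)\<^sup>2) \<partial>M)"
    unfolding S_def by (rule nn_integral_suminf) simp
  also have "\<dots> \<le> (\<Sum>n. ennreal (C * (1/2) ^ n))"
  proof (rule suminf_le)
    fix n
    have "(\<integral>\<^sup>+x. ennreal (2 ^ n * (d n x)\<^sup>2) \<partial>M) = ennreal (2 ^ n) * ennreal (l2_inner M (d n) (d n))"
      using dL2[of n]
      by (simp add: ennreal_mult nn_integral_cmult nn_integral_square_L2)
    also have "\<dots> = ennreal (2 ^ n * l2_inner M (d n) (d n))"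
      by (simp add: ennreal_mult l2_inner_self_nonneg)
    also have "\<dots> \<le> ennreal (2 ^ n * (C * (1/4) ^ n))"
      using fast[of n "Suc n"] by (intro ennreal_leI mult_left_mono) (auto simp: d_def[abs_def])
    also have "2 ^ n * (C * (1/4) ^ n) = C * (1/2::real) ^ n"
      by (simp add: power_mult_distrib[symmetric])
    finally show "(\<integral>\<^sup>+x. ennreal (2 ^ n * (d n x)\<^sup>2) \<partial>M) \<le> ennreal (C * (1/2) ^ n)" .
  qed simp_all
  also have "\<dots> < \<infinity>"
    using \<open>0 \<le> C\<close>
    by (subst suminf_ennreal2) (auto intro!: summable_mult summable_geometric)
  finally have fin: "(\<integral>\<^sup>+x. S x \<partial>M) < \<infinity>" .
  have [measurable]: "S \<in> borel_measurable M"
    unfolding S_def[abs_def] by measurable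
  have "AE x in M. S x \<noteq> \<infinity>"
    by (rule nn_integral_PInf_AE[OF _ less_imp_neq[OF fin]]) measurable
  then have conv: "AE x in M. convergent (\<lambda>n. w n x)"
  proof eventually_elim
    case (elim x)
    have "2 ^ n * (d n x)\<^sup>2 \<le> enn2real (S x)" for n
    proof -
      have "(\<Sum>k\<in>{n}. ennreal (2 ^ k * (d k x)\<^sup>2)) \<le> S x"
        unfolding S_def by (rule sum_le_suminf[OF summableI]) simp_all
      also have "S x = ennreal (enn2real (S x))"
        using elim by (simp add: ennreal_enn2real_if)
      finally have "ennreal (2 ^ n * (d n x)\<^sup>2) \<le> ennreal (enn2real (S x))"
        by simp
      then show ?thesis
        by (subst (asm) ennreal_le_iff) (rule enn2real_nonneg)
    qed
    then have dle: "\<bar>d n x\<bar> \<le> sqrt (enn2real (S x)) * (1 / sqrt 2) ^ n" for n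
    proof -
      have "(sqrt 2 ^ n)\<^sup>2 = (2::real) ^ n"
        by (metis power_mult mult.commute real_sqrt_pow2 zero_le_numeral)
      then have "(sqrt 2 ^ n * \<bar>d n x\<bar>)\<^sup>2 \<le> enn2real (S x)"
        using \<open>2 ^ n * (d n x)\<^sup>2 \<le> enn2real (S x)\<close>
        by (simp only: power_mult_distrib power2_abs)
      then have "sqrt 2 ^ n * \<bar>d n x\<bar> \<le> sqrt (enn2real (S x))"
        by (rule real_le_rsqrt)
      then show ?thesis by (simp add: field_simps power_divide)
    qed
    have "summable (\<lambda>n. sqrt (enn2real (S x)) * (1 / sqrt 2) ^ n)"
      by (rule summable_mult[OF summable_geometric]) simp
    from summable_comparison_test'[OF this, of 0 "\<lambda>n. d n x"]
    have "summable (\<lambda>n. d n x)"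
      using dle by (simp only: real_norm_def)
    then have "convergent (\<lambda>n. w 0 x + (\<Sum>k<n. d k x))"
      by (simp only: convergent_add_const_iff summable_iff_convergent)
    moreover have "w 0 x + (\<Sum>k<n. d k x) = w n x" for n
      by (induction n) (auto simp: d_def)
    ultimately show ?case by simp
  qed
  define u where "u x = lim (\<lambda>n. w n x)" for x
  have um [measurable]: "u \<in> borel_measurable M"
    unfolding u_def[abs_def] by (rule borel_measurable_lim_metric) simp
  have bound: "(\<integral>\<^sup>+x. ennreal ((w n x - u x)\<^sup>2) \<partial>M) \<le> ennreal (C * (1/4) ^ n)" for n
  proof -
    have "(\<integral>\<^sup>+x. ennreal ((w n x - u x)\<^sup>2) \<partial>M)
        = (\<integral>\<^sup>+x. liminf (\<lambda>m. ennreal ((w m x - w n x)\<^sup>2)) \<partial>M)"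
    proof (rule nn_integral_cong_AE, use conv in eventually_elim)
      case (elim x)
      then have "(\<lambda>m. w m x) \<longlonglongrightarrow> u x"
        by (simp add: u_def convergent_LIMSEQ_iff)
      then have "(\<lambda>m. ennreal ((w m x - w n x)\<^sup>2)) \<longlonglongrightarrow> ennreal ((u x - w n x)\<^sup>2)"
        by (intro tendsto_ennrealI tendsto_intros)
      from lim_imp_Liminf[OF sequentially_bot this] show ?case
        by (simp only: power2_commute[of "w n x" "u x"])
    qed
    also have "\<dots> \<le> liminf (\<lambda>m. \<integral>\<^sup>+x. ennreal ((w m x - w n x)\<^sup>2) \<partial>M)"
      by (rule nn_integral_liminf) simp
    also have "\<dots> \<le> liminf (\<lambda>m::nat. ennreal (C * (1/4) ^ n))"
    proof (rule Liminf_mono, rule eventually_mono[OF eventually_ge_at_top[of n]])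
      fix m assume "n \<le> m"
      then show "(\<integral>\<^sup>+x. ennreal ((w m x - w n x)\<^sup>2) \<partial>M) \<le> ennreal (C * (1/4) ^ n)"
        using fast[of n m] L2_diff[OF w w, of m n]
        by (simp add: nn_integral_square_L2 ennreal_leI)
    qed
    also have "\<dots> = ennreal (C * (1/4) ^ n)"
      by (simp add: Liminf_const)
    finally show ?thesis .
  qed
  have diff: "(\<lambda>x. w n x - u x) \<in> L2 M"
    "l2_inner M (\<lambda>x. w n x - u x) (\<lambda>x. w n x - u x) \<le> C * (1/4) ^ n" for n
    using L2_of_nn_integral_square_le[OF _ bound[of n]] \<open>0 \<le> C\<close> by auto
  have "u \<in> L2 M"
    using L2_diff[OF w diff(1), of 0 0] by simp
  moreover have "(\<lambda>n. l2_norm M (\<lambda>x. w n x - u x)) \<longlonglongrightarrow> 0"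
  proof -
    have "(\<lambda>n. (1/4::real) ^ n) \<longlonglongrightarrow> 0"
      by (rule LIMSEQ_power_zero) simp
    from tendsto_mult_right_zero[OF this, of C] have "(\<lambda>n. l2_inner M (\<lambda>x. w n x - u x) (\<lambda>x. w n x - u x)) \<longlonglongrightarrow> 0"
      by (rule tendsto_sandwich[OF _ _ tendsto_const, rotated 2])
         (auto simp: diff l2_inner_self_nonneg)
    from tendsto_real_sqrt[OF this] show ?thesis
      by (simp add: l2_norm_def)
  qed
  ultimately show ?thesis by blast
qed


lemma abs_l2_inner_le_l2_norms:
  assumes "f \<in> L2 M" "g \<in> L2 M"
  shows "\<bar>l2_inner M f g\<bar> \<le> l2_norm M f * l2_norm M g"
  using real_sqrt_le_mono[OF l2_inner_Cauchy_Schwarz[OF assms]]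
  by (simp add: l2_norm_def real_sqrt_mult)

lemma tendsto_l2_inner_self_diff:
  assumes "u \<in> L2 M" "w \<in> L2 M" "\<And>n. a n \<in> L2 M"
    and lim: "(\<lambda>n. l2_norm M (\<lambda>x. a n x - w x)) \<longlonglongrightarrow> 0"
  shows "(\<lambda>n. l2_inner M (\<lambda>x. u x - a n x) (\<lambda>x. u x - a n x))
    \<longlonglongrightarrow> l2_inner M (\<lambda>x. u x - w x) (\<lambda>x. u x - w x)"
proof -
  let ?p = "\<lambda>x. u x - w x" and ?q = "\<lambda>n x. a n x - w x"
  have L: "?p \<in> L2 M" "?q n \<in> L2 M" for n
    using assms by (auto intro: L2_diff)
  have eq: "l2_inner M (\<lambda>x. u x - a n x) (\<lambda>x. u x - a n x) =
      l2_inner M ?p ?p - 2 * l2_inner M ?p (?q n) + (l2_norm M (?q n))\<^sup>2" for n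
    using l2_inner_lincomb_self[OF L(1) L(2)[of n], of 1 "-1"]
    by (simp add: l2_norm_def l2_inner_self_nonneg)
  have "(\<lambda>n. l2_norm M ?p * l2_norm M (?q n)) \<longlonglongrightarrow> 0"
    using tendsto_mult_right_zero[OF lim] by simp
  then have "(\<lambda>n. l2_inner M ?p (?q n)) \<longlonglongrightarrow> 0"
    by (rule Lim_null_comparison[rotated]) (use abs_l2_inner_le_l2_norms[OF L] in simp)
  then have "(\<lambda>n. l2_inner M ?p ?p - 2 * l2_inner M ?p (?q n) + (l2_norm M (?q n))\<^sup>2)
      \<longlonglongrightarrow> l2_inner M ?p ?p - 2 * 0 + 0\<^sup>2"
    using lim by (intro tendsto_intros)
  then show ?thesis by (simp add: eq)
qed


section \<open>Two-homogeneous convex energies\<close>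

locale two_homogeneous_energy =
  fixes M :: "'a measure" and E :: "('a \<Rightarrow> real) \<Rightarrow> ennreal"
  assumes convex: "convex_functional M E"
    and lsc: "lsc_functional M E"
    and homogeneous: "two_homogeneous M E"
begin

abbreviation energy :: "('a \<Rightarrow> real) \<Rightarrow> real" where
  "energy u \<equiv> enn2real (E u)"

lemma form_dom_L2: "u \<in> form_dom M E \<Longrightarrow> u \<in> L2 M"
  by (simp add: form_dom_def)

lemma ennreal_energy: "u \<in> form_dom M E \<Longrightarrow> ennreal (energy u) = E u"
  by (simp add: form_dom_def ennreal_enn2real_if)

lemma enn2ereal_E: "u \<in> form_dom M E \<Longrightarrow> enn2ereal (E u) = ereal (energy u)"
  by (metis ennreal_energy enn2ereal_ennreal enn2real_nonneg)

lemma form_domI: "u \<in> L2 M \<Longrightarrow> E u \<le> ennreal c \<Longrightarrow> u \<in> form_dom M E"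
  by (auto simp: form_dom_def top_unique)

lemma convex_combination_le:
  assumes "u \<in> form_dom M E" "v \<in> form_dom M E" "0 \<le> t" "t \<le> 1"
  shows "E (\<lambda>x. t * u x + (1 - t) * v x) \<le> ennreal (t * energy u + (1 - t) * energy v)"
proof -
  have "E (\<lambda>x. t * u x + (1 - t) * v x) \<le> ennreal t * E u + ennreal (1 - t) * E v"
    using convex assms by (auto simp: convex_functional_def form_dom_def)
  also have "\<dots> = ennreal (t * energy u + (1 - t) * energy v)"
    using assms by (simp add: ennreal_energy ennreal_mult)
  finally show ?thesis .
qed

lemma form_dom_convex_combination:
  assumes "u \<in> form_dom M E" "v \<in> form_dom M E" "0 \<le> t" "t \<le> 1"
  shows "(\<lambda>x. t * u x + (1 - t) * v x) \<in> form_dom M E"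
  using form_domI[OF _ convex_combination_le[OF assms]] assms
  by (simp add: form_dom_L2 L2_lincomb)

lemma energy_convex:
  assumes "u \<in> form_dom M E" "v \<in> form_dom M E" "0 \<le> t" "t \<le> 1"
  shows "energy (\<lambda>x. t * u x + (1 - t) * v x) \<le> t * energy u + (1 - t) * energy v"
  by (rule enn2real_leI[OF _ convex_combination_le[OF assms]]) (use assms in simp)

lemma form_dom_scale:
  assumes "u \<in> form_dom M E"
  shows "(\<lambda>x. a * u x) \<in> form_dom M E"
  using assms homogeneous
  by (auto simp: form_dom_def two_homogeneous_def L2_scale ennreal_mult_eq_top_iff)

text \<open>
  A sum is twice a midpoint, and the doubling stays in the domain by homogeneity.
\<close>

lemma form_dom_add_scale:
  assumes "u \<in> form_dom M E" "v \<in> form_dom M E"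
  shows "(\<lambda>x. u x + b * v x) \<in> form_dom M E"
  using form_dom_convex_combination[OF form_dom_scale[OF assms(1), of 2]
      form_dom_scale[OF assms(2), of "2 * b"], of "1/2"]
  by simp

lemma form_dom_uminus: "v \<in> form_dom M E \<Longrightarrow> (\<lambda>x. - v x) \<in> form_dom M E"
  using form_dom_scale[of v "-1"] by simp

lemma form_dom_zero: "(\<lambda>x. 0) \<in> form_dom M E"
proof -
  have "E (\<lambda>x. 0) = 0"
    using homogeneous[unfolded two_homogeneous_def, rule_format, OF L2_zero, of 0] by simp
  then show ?thesis by (simp add: form_dom_def L2_zero)
qed


section \<open>One-sided slopes\<close>

lemma diff_quotient_eq:
  assumes "u \<in> form_dom M E" "v \<in> form_dom M E" "s \<noteq> 0"
  shows "diff_quotient E u v s = ereal ((energy (\<lambda>x. u x + s * v x) - energy u) / s)"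
  unfolding diff_quotient_def
  using assms
  by (simp add: enn2ereal_E form_dom_add_scale)

text \<open>
  For \<open>0 < s \<le> r\<close> the point \<open>u + s v\<close> lies on the segment from \<open>u\<close> to \<open>u + r v\<close>.
\<close>

lemma diff_quotient_mono:
  assumes D: "u \<in> form_dom M E" "v \<in> form_dom M E" and "0 < s" "s \<le> r"
  shows "diff_quotient E u v s \<le> diff_quotient E u v r"
proof -
  let ?e = "\<lambda>s. energy (\<lambda>x. u x + s * v x)"
  have comb: "(\<lambda>x. s/r * (u x + r * v x) + (1 - s/r) * u x) = (\<lambda>x. u x + s * v x)"
    using assms by (auto simp: field_simps)
  have "?e s \<le> s/r * ?e r + (1 - s/r) * energy u"
    using energy_convex[OF form_dom_add_scale[OF D, of r] D(1), of "s/r"] assms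
    unfolding comb by simp
  then have "?e s - energy u \<le> s * ((?e r - energy u) / r)"
    by (simp add: algebra_simps diff_divide_distrib)
  then have "(?e s - energy u) / s \<le> (?e r - energy u) / r"
    using \<open>0 < s\<close> by (simp add: pos_divide_le_eq mult.commute)
  then show ?thesis
    using assms by (simp add: diff_quotient_eq)
qed

lemma diff_quotient_tendsto_slope_plus:
  assumes D: "u \<in> form_dom M E" "v \<in> form_dom M E"
  shows "(diff_quotient E u v \<longlongrightarrow> slope_plus E u v) (at_right 0)"
proof -
  let ?I = "INF s\<in>{0<..}. diff_quotient E u v s"
  have "(diff_quotient E u v \<longlongrightarrow> ?I) (at_right 0)"
  proof (rule order_tendstoI)
    fix a assume "a < ?I"
    then show "eventually (\<lambda>s. a < diff_quotient E u v s) (at_right 0)"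
      by (intro eventually_mono[OF eventually_at_right_less[of 0]])
         (auto intro: less_le_trans INF_lower)
  next
    fix a assume "?I < a"
    then obtain r where r: "0 < r" "diff_quotient E u v r < a"
      by (auto simp: INF_less_iff)
    show "eventually (\<lambda>s. diff_quotient E u v s < a) (at_right 0)"
      using eventually_at_right_real[OF r(1)]
    proof eventually_elim
      case (elim s)
      then show ?case
        using diff_quotient_mono[OF D, of s r] r(2) by auto
    qed
  qed
  then show ?thesis
    unfolding slope_plus_def by (simp add: tendsto_Lim)
qed

lemma le_slope_plusI:
  assumes "u \<in> form_dom M E" "v \<in> form_dom M E"
    and "\<And>s. 0 < s \<Longrightarrow> c \<le> diff_quotient E u v s"
  shows "c \<le> slope_plus E u v"
  by (rule tendsto_lowerbound[OF diff_quotient_tendsto_slope_plus[OF assms(1,2)]])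
     (auto intro!: eventually_mono[OF eventually_at_right_less[of 0]] assms(3))

lemma slope_minus_eq_uminus_slope_plus:
  assumes D: "u \<in> form_dom M E" "v \<in> form_dom M E"
  shows "slope_minus E u v = - slope_plus E u (\<lambda>x. - v x)"
proof -
  have "((\<lambda>s. - diff_quotient E u (\<lambda>x. - v x) s) \<longlongrightarrow> - slope_plus E u (\<lambda>x. - v x)) (at_right 0)"
    using diff_quotient_tendsto_slope_plus[OF D(1) form_dom_uminus[OF D(2)]]
    by (rule tendsto_uminus_ereal)
  moreover have "eventually (\<lambda>s. - diff_quotient E u (\<lambda>x. - v x) s = diff_quotient E u v (- s)) (at_right 0)"
    using eventually_at_right_less[of "0::real"]
    by eventually_elim (simp add: diff_quotient_eq D form_dom_uminus)
  ultimately have "(diff_quotient E u v \<longlongrightarrow> - slope_plus E u (\<lambda>x. - v x)) (at_left 0)"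
    unfolding filterlim_at_left_to_right by (simp add: tendsto_cong)
  then show ?thesis
    unfolding slope_minus_def by (simp add: tendsto_Lim)
qed


section \<open>Subgradients\<close>

lemma subdiff_le_energy_diff:
  assumes xi: "\<xi> \<in> subdiff M E u" and z: "z \<in> form_dom M E"
  shows "l2_inner M \<xi> (\<lambda>x. z x - u x) \<le> energy z - energy u"
proof -
  have u: "u \<in> form_dom M E" using xi by (simp add: subdiff_def)
  have "ereal (l2_inner M \<xi> (\<lambda>x. z x - u x)) \<le> enn2ereal (E z) - enn2ereal (E u)"
    using xi form_dom_L2[OF z] by (simp add: subdiff_def)
  then show ?thesis
    by (simp add: enn2ereal_E[OF z] enn2ereal_E[OF u])
qed

text \<open>
  Outside the domain the subgradient inequality is trivial, so it is enough to test it where the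
  energy is finite and to compute with real numbers.
\<close>

lemma subdiffI:
  assumes "\<xi> \<in> L2 M" and u: "u \<in> form_dom M E"
    and le: "\<And>z. z \<in> form_dom M E \<Longrightarrow> l2_inner M \<xi> (\<lambda>x. z x - u x) \<le> energy z - energy u"
  shows "\<xi> \<in> subdiff M E u"
proof -
  have "ereal (l2_inner M \<xi> (\<lambda>x. z x - u x)) \<le> enn2ereal (E z) - enn2ereal (E u)"
    if "z \<in> L2 M" for z
  proof (cases "E z = \<infinity>")
    case True
    then show ?thesis by (simp add: enn2ereal_E[OF u])
  next
    case False
    then have z: "z \<in> form_dom M E" using that by (simp add: form_dom_def)
    then show ?thesis
      using le[OF z] by (simp add: enn2ereal_E[OF z] enn2ereal_E[OF u])
  qed
  then show ?thesis using assms by (simp add: subdiff_def)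
qed

lemma subdiff_le_slope_plus:
  assumes xi: "\<xi> \<in> subdiff M E u" and v: "v \<in> form_dom M E"
  shows "ereal (l2_inner M \<xi> v) \<le> slope_plus E u v"
proof -
  have u: "u \<in> form_dom M E" using xi by (simp add: subdiff_def)
  show ?thesis
  proof (rule le_slope_plusI[OF u v])
    fix s :: real assume "0 < s"
    have "s * l2_inner M \<xi> v \<le> energy (\<lambda>x. u x + s * v x) - energy u"
      using subdiff_le_energy_diff[OF xi form_dom_add_scale[OF u v, of s]]
      by (simp add: l2_inner_scale_right)
    then show "ereal (l2_inner M \<xi> v) \<le> diff_quotient E u v s"
      using \<open>0 < s\<close> by (simp add: diff_quotient_eq u v pos_le_divide_eq mult.commute)
  qed
qed

lemma slope_minus_le_subdiff:
  assumes xi: "\<xi> \<in> subdiff M E u" and v: "v \<in> form_dom M E"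
  shows "slope_minus E u v \<le> ereal (l2_inner M \<xi> v)"
proof -
  have u: "u \<in> form_dom M E" using xi by (simp add: subdiff_def)
  have "- ereal (l2_inner M \<xi> v) \<le> slope_plus E u (\<lambda>x. - v x)"
    using subdiff_le_slope_plus[OF xi form_dom_uminus[OF v]]
      l2_inner_scale_right[of M \<xi> "-1" v] by simp
  then show ?thesis
    unfolding slope_minus_eq_uminus_slope_plus[OF u v]
    using ereal_uminus_le_reorder by blast
qed


section \<open>The resolvent\<close>

text \<open>
  The quadratic term is uniformly convex: if two points are within \<open>\<epsilon>\<close> of the infimum, comparing
  with their midpoint bounds the square of their distance by \<open>8 \<lambda> \<epsilon>\<close>. A minimising sequence
  therefore converges, and its limit is a minimiser by lower semicontinuity.
\<close>

lemma proximal_minimizer_exists: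
  assumes u: "u \<in> L2 M" and "0 < lam"
  shows "\<exists>w \<in> form_dom M E. \<forall>z \<in> form_dom M E.
    energy w + l2_inner M (\<lambda>x. u x - w x) (\<lambda>x. u x - w x) / (2 * lam) \<le>
    energy z + l2_inner M (\<lambda>x. u x - z x) (\<lambda>x. u x - z x) / (2 * lam)"
proof -
  define N where "N z = l2_inner M (\<lambda>x. u x - z x) (\<lambda>x. u x - z x)" for z
  define G where "G z = energy z + N z / (2 * lam)" for z
  define I where "I = Inf (G ` form_dom M E)"
  have G0: "0 \<le> G z" for z
    unfolding G_def N_def using \<open>0 < lam\<close> by (simp add: l2_inner_self_nonneg)
  have I_le: "I \<le> G z" if "z \<in> form_dom M E" for z
    unfolding I_def using that G0 by (intro cInf_lower bdd_belowI2[where m = 0]) auto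
  have "\<exists>z \<in> form_dom M E. G z < I + (1/4) ^ n" for n :: nat
  proof -
    have "\<exists>y \<in> G ` form_dom M E. y < I + (1/4) ^ n"
      using cInf_lessD[of "G ` form_dom M E" "I + (1/4) ^ n"] form_dom_zero
      unfolding I_def[symmetric] by auto
    then show ?thesis by blast
  qed
  then obtain a where aD: "\<And>n. a n \<in> form_dom M E" and aG: "\<And>n. G (a n) < I + (1/4) ^ n"
    by metis
  have aL: "a n \<in> L2 M" for n using aD form_dom_L2 by blast
  have "l2_inner M (\<lambda>x. a m x - a n x) (\<lambda>x. a m x - a n x) \<le> (8 * lam) * (1/4) ^ n"
    if "n \<le> m" for m n
  proof -
    (* The parallelogram law, in the form
       |(p + q)/2|^2 = |p|^2/2 + |q|^2/2 - |p - q|^2/4. *)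
    let ?p = "\<lambda>x. u x - a m x" and ?q = "\<lambda>x. u x - a n x"
    let ?mid = "\<lambda>x. 1/2 * a m x + (1 - 1/2) * a n x"
    have L: "?p \<in> L2 M" "?q \<in> L2 M"
      using u aL by (auto intro: L2_diff)
    have "(\<lambda>x. 1/2 * ?p x + 1/2 * ?q x) = (\<lambda>x. u x - ?mid x)"
      by (auto simp: field_simps)
    then have Nmid: "N ?mid = N (a m) / 4 + l2_inner M ?p ?q / 2 + N (a n) / 4"
      unfolding N_def using l2_inner_lincomb_self[OF L, of "1/2" "1/2"]
      by (simp add: power2_eq_square)
    have diff: "l2_inner M (\<lambda>x. a m x - a n x) (\<lambda>x. a m x - a n x)
        = N (a m) - 2 * l2_inner M ?p ?q + N (a n)"
      unfolding N_def using l2_inner_lincomb_self[OF L, of "-1" 1] by simp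
    have "energy ?mid \<le> energy (a m) / 2 + energy (a n) / 2"
      using energy_convex[OF aD[of m] aD[of n], of "1/2"] by simp
    moreover define \<alpha> \<beta> \<gamma> \<delta> \<epsilon> where "\<alpha> = N (a m) / (2 * lam)" and "\<beta> = N (a n) / (2 * lam)"
      and "\<gamma> = l2_inner M (\<lambda>x. a m x - a n x) (\<lambda>x. a m x - a n x) / (8 * lam)"
      and "\<delta> = (1/4::real) ^ m" and "\<epsilon> = (1/4::real) ^ n"
    moreover have "N ?mid / (2 * lam) = \<alpha> / 2 + \<beta> / 2 - \<gamma>"
      unfolding Nmid diff \<alpha>_def \<beta>_def \<gamma>_def using \<open>0 < lam\<close> by (simp add: field_simps)
    moreover have "I \<le> energy ?mid + N ?mid / (2 * lam)"
      using form_dom_convex_combination[OF aD[of m] aD[of n], of "1/2"]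
      unfolding G_def[symmetric] by (intro I_le) simp
    moreover have "\<delta> \<le> \<epsilon>"
      unfolding \<delta>_def \<epsilon>_def using that by (intro power_decreasing) auto
    moreover have "energy (a m) + \<alpha> < I + \<delta>" "energy (a n) + \<beta> < I + \<epsilon>"
      using aG[of m] aG[of n] unfolding G_def \<alpha>_def \<beta>_def \<delta>_def \<epsilon>_def by auto
    ultimately have "\<gamma> \<le> \<epsilon>" by linarith
    then have "l2_inner M (\<lambda>x. a m x - a n x) (\<lambda>x. a m x - a n x) / (8 * lam) \<le> (1/4) ^ n"
      by (simp only: \<gamma>_def \<epsilon>_def)
    then show ?thesis using \<open>0 < lam\<close> by (simp add: pos_divide_le_eq mult.commute)
  qed
  then obtain w where wL: "w \<in> L2 M" and lim: "(\<lambda>n. l2_norm M (\<lambda>x. a n x - w x)) \<longlonglongrightarrow> 0"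
    using L2_complete_fast[of a M "8 * lam"] aL \<open>0 < lam\<close> by auto
  have "(\<lambda>n. (1/4::real) ^ n) \<longlonglongrightarrow> 0"
    by (rule LIMSEQ_power_zero) simp
  from tendsto_add[OF tendsto_const[of I] this]
  have "(\<lambda>n. I + (1/4) ^ n) \<longlonglongrightarrow> I" by simp
  then have "(\<lambda>n. G (a n)) \<longlonglongrightarrow> I"
    by (rule tendsto_sandwich[OF _ _ tendsto_const[of I], rotated 2])
       (auto intro!: always_eventually I_le aD less_imp_le[OF aG])
  moreover have "(\<lambda>n. N (a n)) \<longlonglongrightarrow> N w"
    unfolding N_def by (rule tendsto_l2_inner_self_diff[OF u wL aL lim])
  ultimately have "(\<lambda>n. G (a n) - N (a n) / (2 * lam)) \<longlonglongrightarrow> I - N w / (2 * lam)"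
    using \<open>0 < lam\<close> by (intro tendsto_intros) auto
  then have elim: "(\<lambda>n. energy (a n)) \<longlonglongrightarrow> I - N w / (2 * lam)"
    by (simp add: G_def)
  (* Needed below, since ennreal sends negative numbers to 0. *)
  have nonneg: "0 \<le> I - N w / (2 * lam)"
    by (rule LIMSEQ_le_const[OF elim]) simp
  have "E w \<le> liminf (\<lambda>n. E (a n))"
    using lsc wL aL lim by (auto simp: lsc_functional_def)
  also have "\<dots> = ennreal (I - N w / (2 * lam))"
    using tendsto_ennrealI[OF elim]
    by (intro lim_imp_Liminf) (simp_all add: ennreal_energy[OF aD])
  finally have le: "E w \<le> ennreal (I - N w / (2 * lam))" .
  have wD: "w \<in> form_dom M E" by (rule form_domI[OF wL le])
  have "energy w \<le> I - N w / (2 * lam)"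
    by (rule enn2real_leI[OF nonneg le])
  then have "G w \<le> G z" if "z \<in> form_dom M E" for z
    using I_le[OF that] by (simp add: G_def)
  then show ?thesis
    using wD unfolding G_def N_def by blast
qed

text \<open>
  The Euler-Lagrange inclusion of the minimisation problem: \<open>(u - w) / \<lambda>\<close> is a subgradient at the
  minimiser \<open>w\<close>. This follows by comparing \<open>w\<close> with \<open>t z + (1 - t) w\<close>, dividing by \<open>t\<close> and letting
  \<open>t\<close> tend to \<open>0\<close>, which removes the term quadratic in \<open>t\<close>.
\<close>

lemma resolvent_exists:
  assumes u: "u \<in> L2 M" and "0 < lam"
  shows "\<exists>w. w \<in> L2 M \<and> (\<exists>\<xi> \<in> subdiff M E w. AE x in M. u x = w x + lam * \<xi> x)"
proof -
  obtain w where w: "w \<in> form_dom M E" and min: "\<And>z. z \<in> form_dom M E \<Longrightarrow>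
      energy w + l2_inner M (\<lambda>x. u x - w x) (\<lambda>x. u x - w x) / (2 * lam) \<le>
      energy z + l2_inner M (\<lambda>x. u x - z x) (\<lambda>x. u x - z x) / (2 * lam)"
    using proximal_minimizer_exists[OF assms] by blast
  let ?p = "\<lambda>x. u x - w x"
  have p: "?p \<in> L2 M" using u form_dom_L2[OF w] by (rule L2_diff)
  have "(\<lambda>x. 1 / lam * ?p x) \<in> subdiff M E w"
  proof (rule subdiffI[OF L2_scale[OF p] w])
    fix z assume z: "z \<in> form_dom M E"
    let ?q = "\<lambda>x. z x - w x"
    have q: "?q \<in> L2 M" using z w by (intro L2_diff form_dom_L2)
    have step: "l2_inner M ?p ?q / lam \<le> energy z - energy w + t * (l2_inner M ?q ?q / (2 * lam))"
      if t: "0 < t" "t < 1" for t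
    proof -
      let ?z = "\<lambda>x. t * z x + (1 - t) * w x"
      have "(\<lambda>x. 1 * ?p x + (- t) * ?q x) = (\<lambda>x. u x - ?z x)"
        by (auto simp: algebra_simps)
      then have N: "l2_inner M (\<lambda>x. u x - ?z x) (\<lambda>x. u x - ?z x) =
          l2_inner M ?p ?p - 2 * t * l2_inner M ?p ?q + t\<^sup>2 * l2_inner M ?q ?q"
        using l2_inner_lincomb_self[OF p q, of 1 "- t"] by simp
      have "?z \<in> form_dom M E"
        using z w t by (intro form_dom_convex_combination) auto
      from min[OF this] energy_convex[OF z w, of t] t
      have "energy w + l2_inner M ?p ?p / (2 * lam) \<le> t * energy z + (1 - t) * energy w +
          (l2_inner M ?p ?p - 2 * t * l2_inner M ?p ?q + t\<^sup>2 * l2_inner M ?q ?q) / (2 * lam)"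
        unfolding N by linarith
      moreover have "t * (energy z - energy w + t * (l2_inner M ?q ?q / (2 * lam)) - l2_inner M ?p ?q / lam)
          = (t * energy z + (1 - t) * energy w +
          (l2_inner M ?p ?p - 2 * t * l2_inner M ?p ?q + t\<^sup>2 * l2_inner M ?q ?q) / (2 * lam))
          - (energy w + l2_inner M ?p ?p / (2 * lam))"
        using \<open>0 < lam\<close> by (simp add: field_simps power2_eq_square)
      ultimately have "0 \<le> t * (energy z - energy w + t * (l2_inner M ?q ?q / (2 * lam)) - l2_inner M ?p ?q / lam)"
        by linarith
      then show ?thesis using t by (simp add: zero_le_mult_iff)
    qed
    let ?c = "l2_inner M ?q ?q / (2 * lam)"
    have lim: "((\<lambda>t. energy z - energy w + t * ?c) \<longlongrightarrow> energy z - energy w + 0 * ?c) (at_right 0)"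
      by (intro tendsto_intros)
    have "l2_inner M ?p ?q / lam \<le> energy z - energy w + 0 * ?c"
    proof (rule tendsto_lowerbound[OF lim])
      show "eventually (\<lambda>t. l2_inner M ?p ?q / lam \<le> energy z - energy w + t * ?c) (at_right 0)"
        using eventually_at_right_real[of 0 1, OF zero_less_one]
        by eventually_elim (rule step; simp)
    qed simp
    then show "l2_inner M (\<lambda>x. 1 / lam * ?p x) ?q \<le> energy z - energy w"
      unfolding l2_inner_scale_left by simp
  qed
  moreover have "AE x in M. u x = w x + lam * (1 / lam * ?p x)"
    using \<open>0 < lam\<close> by simp
  ultimately show ?thesis
    by (intro exI[of _ w] conjI form_dom_L2[OF w] bexI[where x = "\<lambda>x. 1 / lam * ?p x"])
qed

text \<open>
  Both inequalities come from the subgradient inequality at the resolvent, tested at \<open>u\<close> and at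
  \<open>u + s v\<close>. The terms in \<open>\<lambda> \<parallel>\<xi>\<parallel>\<^sup>2\<close> produced by \<open>(\<xi>, u - w)\<close> have the favourable sign.
\<close>

lemma resolvent_properties:
  assumes u: "u \<in> form_dom M E" and "0 < lam"
  shows resolvent_form_dom: "resolvent M E lam u \<in> form_dom M E"
    and resolvent_dist_le:
      "l2_inner M (\<lambda>x. resolvent M E lam u x - u x) (\<lambda>x. resolvent M E lam u x - u x)
        \<le> lam * energy u"
    and yosida_inner_le: "\<And>v s. v \<in> form_dom M E \<Longrightarrow>
      s * l2_inner M (yosida M E lam u) v
        \<le> energy (\<lambda>x. u x + s * v x) - energy (resolvent M E lam u)"
proof -
  define w where "w = resolvent M E lam u"
  note uL = form_dom_L2[OF u]
  obtain \<xi> where wL: "w \<in> L2 M" and xi: "\<xi> \<in> subdiff M E w"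
    and ae: "AE x in M. u x = w x + lam * \<xi> x"
    using someI_ex[OF resolvent_exists[OF uL \<open>0 < lam\<close>]]
    unfolding w_def resolvent_def by blast
  have w: "w \<in> form_dom M E" and xiL: "\<xi> \<in> L2 M"
    using xi by (auto simp: subdiff_def)
  have [measurable]: "u \<in> borel_measurable M" "w \<in> borel_measurable M" "\<xi> \<in> borel_measurable M"
    using uL wL xiL by (auto dest: L2_measurable)
  have Y: "l2_inner M (yosida M E lam u) f = l2_inner M \<xi> f" if "f \<in> L2 M" for f
    unfolding yosida_def w_def[symmetric]
    by (rule l2_inner_cong_AE[OF _ _ _ that]) (use ae \<open>0 < lam\<close> in \<open>auto elim!: eventually_mono\<close>)
  have uw: "l2_inner M (\<lambda>x. u x - w x) f = lam * l2_inner M \<xi> f" if "f \<in> L2 M" for f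
    unfolding l2_inner_scale_left[symmetric]
    by (rule l2_inner_cong_AE[OF _ _ _ that]) (use ae in \<open>auto elim!: eventually_mono\<close>)
  have uwL: "(\<lambda>x. u x - w x) \<in> L2 M" using uL wL by (rule L2_diff)
  have xiu: "l2_inner M \<xi> (\<lambda>x. u x - w x) = lam * l2_inner M \<xi> \<xi>"
    using uw[OF xiL] by (simp add: l2_inner_commute)
  have self: "lam * l2_inner M \<xi> \<xi> \<le> energy u - energy w"
    using subdiff_le_energy_diff[OF xi u] xiu by simp
  show "resolvent M E lam u \<in> form_dom M E"
    using w by (simp add: w_def)
  have "l2_inner M (\<lambda>x. w x - u x) (\<lambda>x. w x - u x) = l2_inner M (\<lambda>x. u x - w x) (\<lambda>x. u x - w x)"
    by (simp add: l2_inner_def algebra_simps)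
  also have "\<dots> = lam * (lam * l2_inner M \<xi> \<xi>)"
    by (simp add: uw[OF uwL] xiu)
  also have "\<dots> \<le> lam * energy u"
    using self \<open>0 < lam\<close> enn2real_nonneg[of "E w"] by (intro mult_left_mono) linarith+
  finally show "l2_inner M (\<lambda>x. resolvent M E lam u x - u x) (\<lambda>x. resolvent M E lam u x - u x)
      \<le> lam * energy u"
    by (simp add: w_def)
  fix v s assume v: "v \<in> form_dom M E"
  have "(\<lambda>x. (u x + s * v x) - w x) = (\<lambda>x. 1 * (u x - w x) + s * v x)"
    by auto
  then have "l2_inner M \<xi> (\<lambda>x. (u x + s * v x) - w x) = lam * l2_inner M \<xi> \<xi> + s * l2_inner M \<xi> v"
    using l2_inner_lincomb_right[OF uwL form_dom_L2[OF v] xiL, of 1 s] xiu by simp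
  moreover have "0 \<le> lam * l2_inner M \<xi> \<xi>"
    using \<open>0 < lam\<close> by (simp add: l2_inner_self_nonneg)
  ultimately show "s * l2_inner M (yosida M E lam u) v
      \<le> energy (\<lambda>x. u x + s * v x) - energy (resolvent M E lam u)"
    using subdiff_le_energy_diff[OF xi form_dom_add_scale[OF u v, of s]]
    unfolding w_def[symmetric] Y[OF form_dom_L2[OF v]] by linarith
qed


section \<open>The Yosida regularisation as \<open>\<lambda>\<close> tends to zero\<close>

text \<open>
  Lower semicontinuity along the resolvents, which converge to \<open>u\<close> as \<open>\<lambda>\<close> tends to \<open>0\<close>. It is
  phrased with \<open>eventually\<close> because the limit in \<open>\<lambda>\<close> is not taken along a sequence.
\<close>

lemma energy_resolvent_eventually_gt:
  assumes u: "u \<in> form_dom M E" and a: "a < energy u"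
  shows "eventually (\<lambda>lam. a < energy (resolvent M E lam u)) (at_right 0)"
proof (rule sequentially_imp_eventually_within, safe)
  fix f :: "nat \<Rightarrow> real" assume f: "\<forall>n. f n \<in> {0<..} \<and> f n \<noteq> 0" "f \<longlonglongrightarrow> 0"
  let ?w = "\<lambda>n. resolvent M E (f n) u"
  have pos: "0 < f n" for n using f by simp
  have "(\<lambda>n. f n * energy u) \<longlonglongrightarrow> 0"
    using tendsto_mult_left_zero[OF f(2)] by simp
  then have "(\<lambda>n. l2_inner M (\<lambda>x. ?w n x - u x) (\<lambda>x. ?w n x - u x)) \<longlonglongrightarrow> 0"
    by (rule tendsto_sandwich[OF _ _ tendsto_const, rotated 2])
       (auto intro!: always_eventually l2_inner_self_nonneg resolvent_dist_le[OF u pos])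
  from tendsto_real_sqrt[OF this]
  have "(\<lambda>n. l2_norm M (\<lambda>x. ?w n x - u x)) \<longlonglongrightarrow> 0"
    by (simp add: l2_norm_def)
  then have "E u \<le> liminf (\<lambda>n. E (?w n))"
    using lsc form_dom_L2[OF u] form_dom_L2[OF resolvent_form_dom[OF u pos]]
    by (auto simp: lsc_functional_def)
  show "eventually (\<lambda>n. a < energy (?w n)) sequentially"
  proof (cases "a < 0")
    case True
    then show ?thesis
      by (intro always_eventually allI) (rule less_le_trans[OF _ enn2real_nonneg])
  next
    case False
    then have "ennreal a < E u"
      using a ennreal_less_iff[of a "energy u"] by (simp add: ennreal_energy[OF u])
    also note \<open>E u \<le> _\<close>
    finally have "eventually (\<lambda>n. ennreal a < E (?w n)) sequentially"
      by (rule less_LiminfD)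
    then show ?thesis
    proof eventually_elim
      case (elim n)
      then show ?case
        using False ennreal_less_iff[of a "energy (?w n)"]
        by (simp add: ennreal_energy[OF resolvent_form_dom[OF u pos]])
    qed
  qed
qed

lemma Limsup_yosida_le_slope_plus:
  assumes u: "u \<in> form_dom M E" and v: "v \<in> form_dom M E"
  shows "Limsup (at_right 0) (\<lambda>lam. ereal (l2_inner M (yosida M E lam u) v)) \<le> slope_plus E u v"
proof (rule le_slope_plusI[OF u v])
  fix s :: real assume "0 < s"
  let ?Y = "\<lambda>lam. l2_inner M (yosida M E lam u) v"
  let ?d = "energy (\<lambda>x. u x + s * v x) - energy u"
  have "Limsup (at_right 0) (\<lambda>lam. ereal (?Y lam)) \<le> ereal (?d / s)"
  proof (rule ereal_le_epsilon2)
    fix e :: real assume "0 < e"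
    then have "energy u - s * e < energy u" using \<open>0 < s\<close> by simp
    from energy_resolvent_eventually_gt[OF u this] eventually_at_right_less[of "0::real"]
    have "eventually (\<lambda>lam. ereal (?Y lam) \<le> ereal (?d / s) + ereal e) (at_right 0)"
    proof eventually_elim
      case (elim lam)
      then have "s * ?Y lam \<le> ?d + s * e"
        using yosida_inner_le[OF u elim(2) v, of s] by linarith
      then show ?case
        using \<open>0 < s\<close> by (simp add: field_simps)
    qed
    then show "Limsup (at_right 0) (\<lambda>lam. ereal (?Y lam)) \<le> ereal (?d / s) + ereal e"
      by (rule Limsup_bounded)
  qed
  then show "Limsup (at_right 0) (\<lambda>lam. ereal (?Y lam)) \<le> diff_quotient E u v s"
    using \<open>0 < s\<close> by (simp add: diff_quotient_eq u v)
qed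

lemma slope_minus_le_Liminf_yosida:
  assumes u: "u \<in> form_dom M E" and v: "v \<in> form_dom M E"
  shows "slope_minus E u v \<le> Liminf (at_right 0) (\<lambda>lam. ereal (l2_inner M (yosida M E lam u) v))"
proof -
  have "l2_inner M f (\<lambda>x. - v x) = - l2_inner M f v" for f
    using l2_inner_scale_right[of M f "-1" v] by simp
  then have "- Liminf (at_right 0) (\<lambda>lam. ereal (l2_inner M (yosida M E lam u) v))
      \<le> slope_plus E u (\<lambda>x. - v x)"
    using Limsup_yosida_le_slope_plus[OF u form_dom_uminus[OF v]]
    by (simp flip: ereal_Limsup_uminus)
  then show ?thesis
    unfolding slope_minus_eq_uminus_slope_plus[OF u v]
    using ereal_uminus_le_reorder by blast
qed


section \<open>Testing against a dense domain\<close>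

lemma AE_eq_of_l2_inner_eq_on_form_dom:
  assumes dense: "densely_defined M E" and L: "f \<in> L2 M" "g \<in> L2 M"
    and eq: "\<And>v. v \<in> form_dom M E \<Longrightarrow> l2_inner M f v = l2_inner M g v"
  shows "AE x in M. f x = g x"
proof -
  let ?h = "\<lambda>x. f x - g x"
  have h: "?h \<in> L2 M" using L by (rule L2_diff)
  have "l2_norm M ?h \<le> e" if "0 < e" for e
  proof -
    obtain v where v: "v \<in> form_dom M E" and close: "l2_norm M (\<lambda>x. v x - ?h x) < e"
      using dense[unfolded densely_defined_def, rule_format, OF h \<open>0 < e\<close>] by auto
    have vL: "v \<in> L2 M" by (rule form_dom_L2[OF v])
    have "l2_inner M ?h v = 0"
      using eq[OF v] by (simp add: l2_inner_diff_left[OF L vL])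
    then have "(l2_norm M ?h)\<^sup>2 = \<bar>l2_inner M ?h (\<lambda>x. v x - ?h x)\<bar>"
      using l2_inner_self_nonneg[of M ?h] by (simp only: l2_inner_diff_right[OF vL h h] l2_norm_def
        real_sqrt_pow2 diff_0 abs_minus_cancel abs_of_nonneg)
    also have "\<dots> \<le> l2_norm M ?h * l2_norm M (\<lambda>x. v x - ?h x)"
      by (rule abs_l2_inner_le_l2_norms[OF h L2_diff[OF vL h]])
    also have "\<dots> \<le> l2_norm M ?h * e"
      using close by (intro mult_left_mono) (auto simp: l2_norm_def l2_inner_self_nonneg)
    finally show ?thesis
      using \<open>0 < e\<close> by (cases "l2_norm M ?h \<le> 0") (auto simp: power2_eq_square)
  qed
  then have "l2_norm M ?h \<le> 0"
    by (rule field_le_epsilon[where y = 0, simplified])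
  then have "l2_inner M ?h ?h = 0"
    using l2_inner_self_nonneg[of M ?h] by (simp add: l2_norm_def)
  then show ?thesis
    using AE_zero_of_l2_inner_self[OF h] by simp
qed

end

theorem theorem6p2:
  fixes M :: "'a measure" and E :: "('a \<Rightarrow> real) \<Rightarrow> ennreal"
  assumes "sigma_finite_measure M"
    and "bimeasurable_with_real M"
    and "nonlinear_Dirichlet_form M E"
    and "two_homogeneous M E"
  shows
    "(\<forall>u \<in> dom_subdiff M E. \<forall>\<xi> \<in> subdiff M E u. \<forall>v \<in> form_dom M E.
        slope_minus E u v \<le> ereal (l2_inner M \<xi> v) \<and>
        ereal (l2_inner M \<xi> v) \<le> slope_plus E u v) \<and>
     (\<forall>u \<in> dom_subdiff M E.
        (\<forall>v \<in> form_dom M E. slope_plus E u v = slope_minus E u v) \<longrightarrow>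
        (\<exists>\<xi> \<in> subdiff M E u.
           (\<forall>\<eta> \<in> subdiff M E u. AE x in M. \<eta> x = \<xi> x) \<and>
           (\<forall>v \<in> form_dom M E. slope_plus E u v = ereal (l2_inner M \<xi> v) \<and>
                             slope_minus E u v = ereal (l2_inner M \<xi> v)))) \<and>
     (\<forall>u \<in> form_dom M E. \<forall>v \<in> form_dom M E.
        slope_minus E u v
          \<le> Liminf (at_right 0) (\<lambda>lam. ereal (l2_inner M (yosida M E lam u) v)) \<and>
        Liminf (at_right 0) (\<lambda>lam. ereal (l2_inner M (yosida M E lam u) v))
          \<le> Limsup (at_right 0) (\<lambda>lam. ereal (l2_inner M (yosida M E lam u) v)) \<and>
        Limsup (at_right 0) (\<lambda>lam. ereal (l2_inner M (yosida M E lam u) v))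
          \<le> slope_plus E u v) \<and>
     (regular_form M E \<longrightarrow>
        (\<forall>u \<in> form_dom M E. \<forall>v \<in> form_dom M E.
           ((\<lambda>lam. ereal (l2_inner M (yosida M E lam u) v)) \<longlongrightarrow> slope_plus E u v) (at_right 0) \<and>
           slope_plus E u v = slope_minus E u v))"
proof -
  interpret two_homogeneous_energy M E
    using assms by unfold_locales (auto simp: nonlinear_Dirichlet_form_def)
  have dense: "densely_defined M E"
    using assms by (simp add: nonlinear_Dirichlet_form_def)
  have xi_dom: "u \<in> form_dom M E" "\<xi> \<in> L2 M" if "\<xi> \<in> subdiff M E u" for u \<xi>
    using that by (auto simp: subdiff_def)
  have slope_eq: "slope_plus E u v = ereal (l2_inner M \<xi> v)"
    if "\<xi> \<in> subdiff M E u" "v \<in> form_dom M E" "slope_plus E u v = slope_minus E u v" for u v \<xi>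
    using subdiff_le_slope_plus[OF that(1,2)] slope_minus_le_subdiff[OF that(1,2)] that(3)
    by simp
  have unique: "AE x in M. \<eta> x = \<xi> x"
    if "\<xi> \<in> subdiff M E u" "\<eta> \<in> subdiff M E u"
      "\<forall>v \<in> form_dom M E. slope_plus E u v = slope_minus E u v" for u \<xi> \<eta>
  proof (rule AE_eq_of_l2_inner_eq_on_form_dom[OF dense])
    fix v assume "v \<in> form_dom M E"
    then show "l2_inner M \<eta> v = l2_inner M \<xi> v"
      using slope_eq[of \<xi> u v] slope_eq[of \<eta> u v] that by simp
  qed (use that xi_dom in auto)
  have lim_mid: "Liminf (at_right 0) (\<lambda>lam. ereal (l2_inner M (yosida M E lam u) v))
      \<le> Limsup (at_right 0) (\<lambda>lam. ereal (l2_inner M (yosida M E lam u) v))" for u v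
    by (rule Liminf_le_Limsup) simp
  have regular_slopes: "slope_plus E u v = slope_minus E u v"
    if "regular_form M E" "u \<in> form_dom M E" "v \<in> form_dom M E" for u v
    using that by (simp add: regular_form_def)
  have regular_limit:
    "((\<lambda>lam. ereal (l2_inner M (yosida M E lam u) v)) \<longlongrightarrow> slope_plus E u v) (at_right 0)"
    if "regular_form M E" "u \<in> form_dom M E" "v \<in> form_dom M E" for u v
    using Limsup_yosida_le_slope_plus[OF that(2,3)] slope_minus_le_Liminf_yosida[OF that(2,3)]
      lim_mid[of u v] regular_slopes[OF that]
    by (intro Liminf_eq_Limsup) (auto intro: antisym order_trans)
  show ?thesis
  proof (intro conjI ballI impI)
    fix u assume u: "u \<in> dom_subdiff M E"
      and reg: "\<forall>v \<in> form_dom M E. slope_plus E u v = slope_minus E u v"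
    then obtain \<xi> where xi: "\<xi> \<in> subdiff M E u"
      by (auto simp: dom_subdiff_def)
    show "\<exists>\<xi> \<in> subdiff M E u.
           (\<forall>\<eta> \<in> subdiff M E u. AE x in M. \<eta> x = \<xi> x) \<and>
           (\<forall>v \<in> form_dom M E. slope_plus E u v = ereal (l2_inner M \<xi> v) \<and>
                             slope_minus E u v = ereal (l2_inner M \<xi> v))"
      using xi unique[OF xi _ reg] slope_eq[OF xi] reg by (intro bexI[OF _ xi]) simp
  qed (auto intro: regular_slopes subdiff_le_slope_plus slope_minus_le_subdiff
      Limsup_yosida_le_slope_plus slope_minus_le_Liminf_yosida lim_mid regular_limit)
qed

end
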